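(* Let $V$ and $\mathfrak g$ be finite-dimensional real vector spaces and $\langle\cdot,\cdot\rangle_{\mathfrak g}$ a scalar product on $\mathfrak g$ of neutral signature. Any Dirac structure of $V\oplus V^*\oplus\mathfrak g$ is of the form $$L=\{X+\xi+\sigma(X)+r\mid X\in W,\ \xi\in V^*,\ r\in\mathcal D,\ \xi(Y)=2\epsilon(X,Y)-\langle\sigma(Y),\sigma(X)+2r\rangle_{\mathfrak g}\ \ \forall Y\in W\},\qquad( * )$$ where $W\subset V$ is a subspace, $\mathcal D\subset\mathfrak g$ is a Dirac structure, $\sigma\in\mathrm{Hom}(W,\mathfrak g)$ and $\epsilon\in\Lambda^2W^*$. Conversely, any choice of such data $(W,\mathcal D,\sigma,\epsilon)$ defines by $( * )$ a Dirac structure $L=L(W,\mathcal D,\sigma,\epsilon)\subset V\oplus V^*\oplus\mathfrak g$. The homomorphism $\sigma$ automatically satisfies $\sigma(X)\in\mathcal D_X$ for all $X\in W$, where $\mathcal D_X:=\pi_{\mathfrak g}\big((\pi_V|_L)^{-1}(X)\big)$ is defined with respect to $L=L(W,\mathcal D,\sigma,\epsilon)$.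
   Context: $V\oplus V^*\oplus\mathfrak g$ carries the scalar product $\langle X+\xi+r,Y+\eta+s\rangle=\frac12(\xi(Y)+\eta(X))+\langle r,s\rangle_{\mathfrak g}$, and $\pi_V,\pi_{\mathfrak g}$ denote the projections onto $V,\mathfrak g$. A Dirac structure of a vector space with scalar product of neutral signature is a maximal isotropic subspace (of half the dimension). A scalar product is a non-degenerate symmetric bilinear form. *)

theory Defs
  imports "HOL-Analysis.Analysis"
begin

text \<open>The algebraic dual. Vector spaces are types of class \<^class>\<open>real_vector\<close> rather than
  \<^class>\<open>euclidean_space\<close>, because the latter excludes the zero space.\<close>

typedef (overloaded) 'v dual = "{f :: 'v::real_vector \<Rightarrow> real. linear f}"
  morphisms dual_apply Abs_dual
  by (rule exI[of _ "\<lambda>_. 0"]) (simp add: linear_iff)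

setup_lifting type_definition_dual

instantiation dual :: (real_vector) real_vector
begin

lift_definition zero_dual :: "'a dual" is "\<lambda>_. 0"
  by (simp add: linear_iff)

lift_definition plus_dual :: "'a dual \<Rightarrow> 'a dual \<Rightarrow> 'a dual" is "\<lambda>f g x. f x + g x"
  by (simp add: linear_iff algebra_simps)

lift_definition minus_dual :: "'a dual \<Rightarrow> 'a dual \<Rightarrow> 'a dual" is "\<lambda>f g x. f x - g x"
  by (simp add: linear_iff algebra_simps)

lift_definition uminus_dual :: "'a dual \<Rightarrow> 'a dual" is "\<lambda>f x. - f x"
  by (simp add: linear_iff)

lift_definition scaleR_dual :: "real \<Rightarrow> 'a dual \<Rightarrow> 'a dual" is "\<lambda>c f x. c * f x"
  by (simp add: linear_iff algebra_simps)

instance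
  by standard (transfer; simp add: fun_eq_iff algebra_simps)+

end

definition is_scalar_product :: "('a::real_vector \<Rightarrow> 'a \<Rightarrow> real) \<Rightarrow> bool" where
  "is_scalar_product b \<longleftrightarrow>
     bilinear b \<and> (\<forall>x y. b x y = b y x) \<and> (\<forall>x. (\<forall>y. b x y = 0) \<longrightarrow> x = 0)"

definition has_signature :: "('a::real_vector \<Rightarrow> 'a \<Rightarrow> real) \<Rightarrow> nat \<Rightarrow> nat \<Rightarrow> bool" where
  "has_signature b p q \<longleftrightarrow>
     (\<exists>B. finite B \<and> independent B \<and> span B = UNIV \<and> pairwise (\<lambda>x y. b x y = 0) B \<and>
          card {x \<in> B. b x x > 0} = p \<and> card {x \<in> B. b x x < 0} = q)"

definition neutral_signature :: "('a::real_vector \<Rightarrow> 'a \<Rightarrow> real) \<Rightarrow> bool" where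
  "neutral_signature b \<longleftrightarrow> (\<exists>n. has_signature b n n)"

definition isotropic_subspace :: "('a::real_vector \<Rightarrow> 'a \<Rightarrow> real) \<Rightarrow> 'a set \<Rightarrow> bool" where
  "isotropic_subspace b L \<longleftrightarrow> subspace L \<and> (\<forall>x\<in>L. \<forall>y\<in>L. b x y = 0)"

definition dirac_structure :: "('a::real_vector \<Rightarrow> 'a \<Rightarrow> real) \<Rightarrow> 'a set \<Rightarrow> bool" where
  "dirac_structure b L \<longleftrightarrow>
     isotropic_subspace b L \<and>
     (\<forall>L'. isotropic_subspace b L' \<and> L \<subseteq> L' \<longrightarrow> L' = L) \<and>
     2 * dim L = dim (UNIV :: 'a set)"

text \<open>An element \<open>X + \<xi> + r\<close> of \<open>V \<oplus> V\<^sup>* \<oplus> \<gg>\<close> is the triple \<open>(X, \<xi>, r)\<close>.\<close>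

type_synonym ('v, 'g) sum_space = "'v \<times> 'v dual \<times> 'g"

definition proj_V :: "('v::real_vector, 'g::real_vector) sum_space \<Rightarrow> 'v" where
  "proj_V = (\<lambda>(X, \<xi>, r). X)"

definition proj_g :: "('v::real_vector, 'g::real_vector) sum_space \<Rightarrow> 'g" where
  "proj_g = (\<lambda>(X, \<xi>, r). r)"

definition sum_form ::
  "('g::real_vector \<Rightarrow> 'g \<Rightarrow> real) \<Rightarrow>
   ('v::real_vector, 'g) sum_space \<Rightarrow> ('v, 'g) sum_space \<Rightarrow> real" where
  "sum_form b = (\<lambda>(X, \<xi>, r) (Y, \<eta>, s). (dual_apply \<xi> Y + dual_apply \<eta> X) / 2 + b r s)"

text \<open>Maps with domain a subspace \<open>W\<close> are total functions whose values outside \<open>W\<close> are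
  irrelevant.\<close>

definition linear_on :: "'a::real_vector set \<Rightarrow> ('a \<Rightarrow> 'b::real_vector) \<Rightarrow> bool" where
  "linear_on W f \<longleftrightarrow>
     (\<forall>x\<in>W. \<forall>y\<in>W. f (x + y) = f x + f y) \<and> (\<forall>c. \<forall>x\<in>W. f (c *\<^sub>R x) = c *\<^sub>R f x)"

definition alternating_form_on :: "'a::real_vector set \<Rightarrow> ('a \<Rightarrow> 'a \<Rightarrow> real) \<Rightarrow> bool" where
  "alternating_form_on W \<epsilon> \<longleftrightarrow>
     (\<forall>x\<in>W. linear_on W (\<lambda>y. \<epsilon> x y)) \<and> (\<forall>y\<in>W. linear_on W (\<lambda>x. \<epsilon> x y)) \<and>
     (\<forall>x\<in>W. \<epsilon> x x = 0)"

definition dirac_data ::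
  "('g::real_vector \<Rightarrow> 'g \<Rightarrow> real) \<Rightarrow> 'v::real_vector set \<Rightarrow> 'g set \<Rightarrow>
   ('v \<Rightarrow> 'g) \<Rightarrow> ('v \<Rightarrow> 'v \<Rightarrow> real) \<Rightarrow> bool" where
  "dirac_data b W D \<sigma> \<epsilon> \<longleftrightarrow>
     subspace W \<and> dirac_structure b D \<and> linear_on W \<sigma> \<and> alternating_form_on W \<epsilon>"

definition dirac_of_data ::
  "('g::real_vector \<Rightarrow> 'g \<Rightarrow> real) \<Rightarrow> 'v::real_vector set \<Rightarrow> 'g set \<Rightarrow>
   ('v \<Rightarrow> 'g) \<Rightarrow> ('v \<Rightarrow> 'v \<Rightarrow> real) \<Rightarrow> ('v, 'g) sum_space set" where
  "dirac_of_data b W D \<sigma> \<epsilon> =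
     {(X, \<xi>, \<sigma> X + r) | X \<xi> r. X \<in> W \<and> r \<in> D \<and>
        (\<forall>Y\<in>W. dual_apply \<xi> Y = 2 * \<epsilon> X Y - b (\<sigma> Y) (\<sigma> X + 2 *\<^sub>R r))}"

definition fibre_g :: "('v::real_vector, 'g::real_vector) sum_space set \<Rightarrow> 'v \<Rightarrow> 'g set" where
  "fibre_g L X = proj_g ` {z \<in> L. proj_V z = X}"

end

theory Submission
  imports Defs
begin

text \<open>In a finite-dimensional space with scalar product, \<open>dim S + dim S\<^sup>\<bottom> = dim UNIV\<close>, so Dirac
  structures are exactly the subsets with \<open>S\<^sup>\<bottom> = S\<close>. After extending \<open>\<sigma>\<close> and \<open>\<epsilon>\<close> from \<open>W\<close> to \<open>V\<close>,
  the shear \<open>X + \<xi> + r \<mapsto> X + (\<xi> + 2\<epsilon>(X, \<cdot>) - \<langle>\<sigma>(\<cdot>), \<sigma>(X) + 2r\<rangle>) + (\<sigma>(X) + r)\<close> is an isometry that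
  carries \<open>W \<oplus> W\<^sup>0 \<oplus> D\<close>, where \<open>W\<^sup>0\<close> is the annihilator of \<open>W\<close>, onto \<open>L(W, D, \<sigma>, \<epsilon>)\<close>; the former is
  visibly its own complement. Conversely, given \<open>L\<close>, a linear section \<open>X \<mapsto> X + \<alpha>(X) + \<sigma>(X)\<close> of \<open>\<pi>\<^sub>V\<close>
  on \<open>L\<close> provides \<open>\<sigma>\<close> and \<open>\<epsilon>(X, Y) = (\<alpha>(X)(Y) + \<langle>\<sigma>(Y), \<sigma>(X)\<rangle>) / 2\<close>. With \<open>W = \<pi>\<^sub>V(L)\<close> and
  \<open>D = {r | \<xi> + r \<in> L for some \<xi>}\<close>, isotropy of \<open>L\<close> says \<open>L \<subseteq> L(W, D, \<sigma>, \<epsilon>)\<close>, and taking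
  complements gives equality.\<close>

subsection \<open>Extension from subspaces\<close>

lemma ex_linear_retraction:
  fixes W :: "'a::real_vector set"
  assumes "subspace W"
  obtains p where "linear p" "\<And>x. p x \<in> W" "\<And>x. x \<in> W \<Longrightarrow> p x = x"
  using linear_exists_left_inverse_on[OF linear_id assms] by auto

lemma linear_linear_on_comp:
  assumes "linear p" "\<And>x. p x \<in> W" "linear_on W f"
  shows "linear (\<lambda>x. f (p x))"
  using assms by (simp add: linear_iff linear_on_def)

lemma ex_linear_extending:
  assumes "subspace W" "linear_on W f"
  obtains g where "linear g" "\<And>x. x \<in> W \<Longrightarrow> g x = f x"
  using ex_linear_retraction[OF assms(1)] linear_linear_on_comp[OF _ _ assms(2)] by metis

lemma ex_bilinear_alternating_extending:
  assumes W: "subspace W" and \<epsilon>: "alternating_form_on W \<epsilon>"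
  obtains \<eta> where "bilinear \<eta>" "\<And>X. \<eta> X X = 0"
    "\<And>X Y. X \<in> W \<Longrightarrow> Y \<in> W \<Longrightarrow> \<eta> X Y = \<epsilon> X Y"
proof -
  obtain p where p: "linear p" "\<And>x. p x \<in> W" "\<And>x. x \<in> W \<Longrightarrow> p x = x"
    using ex_linear_retraction[OF W] by blast
  show thesis
  proof
    show "bilinear (\<lambda>X Y. \<epsilon> (p X) (p Y))"
      using \<epsilon> p(1,2) linear_linear_on_comp[OF p(1,2)]
      by (auto simp: bilinear_def alternating_form_on_def)
  qed (use \<epsilon> p in \<open>auto simp: alternating_form_on_def\<close>)
qed

lemma bilinear_alternating_swap:
  assumes "bilinear \<epsilon>" and alt: "\<And>X. \<epsilon> X X = 0"
  shows "\<epsilon> Y X = - \<epsilon> X Y"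
proof -
  have "\<epsilon> (X + Y) (X + Y) = \<epsilon> X X + \<epsilon> Y X + (\<epsilon> X Y + \<epsilon> Y Y)"
    by (simp only: bilinear_ladd[OF assms(1)] bilinear_radd[OF assms(1)])
  then have "\<epsilon> Y X + \<epsilon> X Y = 0" by (simp add: alt)
  then show ?thesis by (simp add: add_eq_0_iff2)
qed

subsection \<open>The dual space\<close>

lemma linear_dual_apply: "linear (dual_apply \<xi>)"
  using dual_apply by blast

lemmas dual_apply_simps = zero_dual.rep_eq plus_dual.rep_eq minus_dual.rep_eq scaleR_dual.rep_eq
  linear_add[OF linear_dual_apply] linear_cmul[OF linear_dual_apply] linear_0[OF linear_dual_apply]

lemma dual_apply_Abs_dual: "linear f \<Longrightarrow> dual_apply (Abs_dual f) = f"
  by (simp add: Abs_dual_inverse)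

lemma dual_eqI: "(\<And>X. dual_apply \<xi> X = dual_apply \<eta> X) \<Longrightarrow> \<xi> = \<eta>"
  by (simp add: dual_apply_inject[symmetric] fun_eq_iff)

definition annihilator :: "'v::real_vector set \<Rightarrow> 'v dual set" where
  "annihilator W = {\<xi>. \<forall>Y\<in>W. dual_apply \<xi> Y = 0}"

lemma ex_annihilator_separating:
  fixes W :: "'v::real_vector set"
  assumes W: "subspace W" and "Z \<notin> W"
  obtains \<xi> where "\<xi> \<in> annihilator W" "dual_apply \<xi> Z \<noteq> 0"
proof -
  obtain p where p: "linear p" "\<And>X. p X \<in> W" "\<And>X. X \<in> W \<Longrightarrow> p X = X"
    using ex_linear_retraction[OF W] by blast
  have "Z - p Z \<noteq> 0" using p(2)[of Z] \<open>Z \<notin> W\<close> by auto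
  then obtain f :: "'v \<Rightarrow> real" where f: "linear f" "f (Z - p Z) = 1"
    using linear_independent_extend[of "{Z - p Z}" "\<lambda>_. 1"] by auto
  define \<xi> where "\<xi> = Abs_dual (\<lambda>X. f (X - p X))"
  have "linear (\<lambda>X. f (X - p X))"
    using linear_compose[OF linear_compose_sub[OF linear_ident p(1)] f(1)] by (simp add: o_def)
  then have "dual_apply \<xi> X = f (X - p X)" for X
    by (simp add: \<xi>_def dual_apply_Abs_dual)
  then show thesis
    using f p(3) by (intro that[of \<xi>]) (auto simp: annihilator_def linear_0)
qed

subsection \<open>Finite bases\<close>

abbreviation (input) finite_basis :: "'a::real_vector set \<Rightarrow> bool" where
  "finite_basis \<equiv> finite_dimensional_vector_space ((*\<^sub>R) :: real \<Rightarrow> 'a \<Rightarrow> 'a)"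

lemma finite_basis_iff: "finite_basis B \<longleftrightarrow> finite B \<and> independent B \<and> span B = UNIV"
proof
  assume "finite_basis B"
  then interpret finite_dimensional_vector_space "(*\<^sub>R) :: real \<Rightarrow> 'a \<Rightarrow> 'a" B .
  show "finite B \<and> independent B \<and> span B = UNIV"
    using finite_Basis independent_Basis span_Basis by (simp add: dependent_raw_def span_raw_def)
next
  assume "finite B \<and> independent B \<and> span B = UNIV"
  then show "finite_basis B"
    by unfold_locales (simp_all add: dependent_raw_def span_raw_def)
qed

lemma finite_basis_if_independent:
  fixes A B :: "'a::real_vector set"
  assumes "finite_basis A" "independent B" "span B = UNIV"
  shows "finite_basis B"
  using assms independent_span_bound[of A B] by (simp add: finite_basis_iff)

lemma finite_basis_extending:
  fixes A B :: "'a::real_vector set"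
  assumes "finite_basis A" "independent B"
  obtains C where "B \<subseteq> C" "finite_basis C"
proof -
  obtain C where C: "B \<subseteq> C" "independent C" "span C = UNIV"
    by (metis maximal_independent_subset_extend[OF subset_UNIV assms(2)] top.extremum_uniqueI)
  show thesis
    by (rule that[OF C(1) finite_basis_if_independent[OF assms(1) C(2,3)]])
qed

lemma finite_basis_if_linear_inj:
  fixes f :: "'a::real_vector \<Rightarrow> 'b::real_vector" and A :: "'b set"
  assumes A: "finite_basis A" and f: "linear f" "inj f"
  obtains B :: "'a set" where "finite_basis B"
proof -
  obtain B :: "'a set" where B: "independent B" "span B = UNIV"
    by (metis maximal_independent_subset[of UNIV] top.extremum_uniqueI)
  have "independent (f ` B)"
    using linear_independent_injective_image[OF f(1) B(1)] inj_on_subset[OF f(2)] by blast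
  then have "finite (f ` B)"
    using A independent_span_bound[of A "f ` B"] by (simp add: finite_basis_iff)
  then have "finite B"
    using finite_imageD inj_on_subset[OF f(2)] by blast
  then show thesis using B that by (simp add: finite_basis_iff)
qed

lemma finite_basis_prod:
  fixes A :: "'a::real_vector set" and B :: "'b::real_vector set"
  assumes "finite_basis A" "finite_basis B"
  shows "finite_basis (A \<times> {0} \<union> {0} \<times> B)"
proof -
  interpret A: finite_dimensional_vector_space "(*\<^sub>R) :: real \<Rightarrow> 'a \<Rightarrow> 'a" A by fact
  interpret B: finite_dimensional_vector_space "(*\<^sub>R) :: real \<Rightarrow> 'b \<Rightarrow> 'b" B by fact
  interpret finite_dimensional_vector_space_prod
    "(*\<^sub>R) :: real \<Rightarrow> 'a \<Rightarrow> 'a" "(*\<^sub>R) :: real \<Rightarrow> 'b \<Rightarrow> 'b" A B ..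
  show ?thesis
    using p.finite_dimensional_vector_space_axioms
    by (simp add: Basis_pair_def module_prod_scale_eq_scaleR)
qed

definition coefficient_vector :: "'a::real_vector set \<Rightarrow> ('a \<Rightarrow> real) \<Rightarrow> 'a" where
  "coefficient_vector B f = (\<Sum>v\<in>B. f v *\<^sub>R v)"

lemma coefficient_vector_in_span_Diff_iff:
  assumes C: "finite C" "independent C" and "B \<subseteq> C"
  shows "coefficient_vector C f \<in> span (C - B) \<longleftrightarrow> (\<forall>v\<in>B. f v = 0)"
proof
  assume mem: "coefficient_vector C f \<in> span (C - B)"
  show "\<forall>v\<in>B. f v = 0"
  proof
    fix v assume "v \<in> B"
    have "f v = representation C (coefficient_vector C f) v"
      using C \<open>v \<in> B\<close> \<open>B \<subseteq> C\<close>
      by (simp add: coefficient_vector_def representation_sum representation_scale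
          representation_basis span_base span_scale subset_iff if_distrib[of "(*) _"] cong: if_cong)
    also have "\<dots> = representation (C - B) (coefficient_vector C f) v"
      using representation_extend[OF C(2) mem] by simp
    also have "\<dots> = 0"
      using representation_ne_zero[of "C - B"] \<open>v \<in> B\<close> by blast
    finally show "f v = 0" .
  qed
next
  assume "\<forall>v\<in>B. f v = 0"
  then have "f v *\<^sub>R v \<in> span (C - B)" if "v \<in> C" for v
    using that by (cases "v \<in> B") (auto simp: span_zero intro: span_scale span_base)
  then show "coefficient_vector C f \<in> span (C - B)"
    unfolding coefficient_vector_def by (rule span_sum)
qed

lemma coefficient_vector_eq_0_imp:
  assumes B: "finite_basis B" and f: "linear f" and "coefficient_vector B f = 0"
  shows "f x = 0"
proof -
  have "\<forall>v\<in>B. f v = 0"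
    using coefficient_vector_in_span_Diff_iff[of B B f] assms by (simp add: finite_basis_iff)
  then show ?thesis
    using linear_eq_0_on_span[OF f, of B x] B by (simp add: finite_basis_iff)
qed

lemma finite_basis_dual:
  fixes B :: "'v::real_vector set"
  assumes B: "finite_basis B"
  obtains E :: "'v dual set" where "finite_basis E"
proof -
  let ?f = "\<lambda>\<xi> :: 'v dual. coefficient_vector B (dual_apply \<xi>)"
  have lin: "linear ?f"
    by (auto intro!: linearI simp: coefficient_vector_def dual_apply_simps scaleR_add_left
        sum.distrib scaleR_sum_right)
  have "inj ?f"
    unfolding linear_injective_0[OF lin]
    using coefficient_vector_eq_0_imp[OF B linear_dual_apply]
    by (auto intro!: dual_eqI simp: dual_apply_simps)
  then show thesis using finite_basis_if_linear_inj[OF B lin] that by blast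
qed

lemma finite_basis_sum_space:
  fixes A :: "'v::real_vector set" and B :: "'g::real_vector set"
  assumes "finite_basis A" "finite_basis B"
  obtains C :: "('v, 'g) sum_space set" where "finite_basis C"
proof -
  obtain E :: "'v dual set" where "finite_basis E"
    using finite_basis_dual[OF assms(1)] .
  then show thesis by (rule that[OF finite_basis_prod[OF assms(1) finite_basis_prod[OF _ assms(2)]]])
qed

subsection \<open>Orthogonal complements\<close>

definition orth_compl :: "('a::real_vector \<Rightarrow> 'a \<Rightarrow> real) \<Rightarrow> 'a set \<Rightarrow> 'a set" where
  "orth_compl b S = {x. \<forall>y\<in>S. b x y = 0}"

lemma orth_compl_antimono: "S \<subseteq> T \<Longrightarrow> orth_compl b T \<subseteq> orth_compl b S"
  by (auto simp: orth_compl_def)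

lemma subset_orth_compl_iff: "S \<subseteq> orth_compl b T \<longleftrightarrow> (\<forall>x\<in>S. \<forall>y\<in>T. b x y = 0)"
  by (auto simp: orth_compl_def)

lemma orth_compl_image_isometry:
  assumes "surj f" "\<And>x y. b' (f x) (f y) = b x y"
  shows "orth_compl b' (f ` S) = f ` orth_compl b S"
proof (intro subset_antisym subsetI)
  fix z assume "z \<in> orth_compl b' (f ` S)"
  moreover obtain x where "z = f x" using \<open>surj f\<close> by blast
  ultimately show "z \<in> f ` orth_compl b S" by (auto simp: orth_compl_def assms(2))
qed (auto simp: orth_compl_def assms(2))

locale scalar_product =
  fixes b :: "'a::real_vector \<Rightarrow> 'a \<Rightarrow> real"
  assumes is_scalar_product: "is_scalar_product b"
begin

lemma bilinear: "bilinear b"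
  using is_scalar_product by (simp add: is_scalar_product_def)

lemma commute: "b x y = b y x"
  using is_scalar_product by (simp add: is_scalar_product_def)

lemma nondegenerate: "(\<And>y. b x y = 0) \<Longrightarrow> x = 0"
  using is_scalar_product by (simp add: is_scalar_product_def)

lemmas form_simps = bilinear_ladd[OF bilinear] bilinear_radd[OF bilinear]
  bilinear_lmul[OF bilinear] bilinear_rmul[OF bilinear]
  bilinear_lsub[OF bilinear] bilinear_rsub[OF bilinear]
  bilinear_lzero[OF bilinear] bilinear_rzero[OF bilinear]

lemma linear_form: "linear (b x)"
  using bilinear by (simp add: bilinear_def)

lemma subspace_orth_compl: "subspace (orth_compl b S)"
  by (auto simp: subspace_def orth_compl_def form_simps)

lemma subspace_if_orth_compl_eq: "orth_compl b S = S \<Longrightarrow> subspace S"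
  by (metis subspace_orth_compl)

lemma orth_compl_span: "orth_compl b (span S) = orth_compl b S"
proof
  show "orth_compl b S \<subseteq> orth_compl b (span S)"
    using linear_eq_0_on_span[OF linear_form] by (fastforce simp: orth_compl_def)
qed (simp add: orth_compl_antimono span_superset)

lemma linear_coefficient_vector: "linear (\<lambda>x. coefficient_vector C (b x))"
  by (auto intro!: linearI simp: coefficient_vector_def form_simps scaleR_add_left sum.distrib
      scaleR_sum_right)

lemma inj_coefficient_vector:
  assumes "finite_basis C"
  shows "inj (\<lambda>x. coefficient_vector C (b x))"
  unfolding linear_injective_0[OF linear_coefficient_vector]
  using coefficient_vector_eq_0_imp[OF assms linear_form] nondegenerate by blast

lemma dim_orth_compl:
  fixes A S :: "'a set"
  assumes "finite_basis A" and S: "subspace S"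
  shows "dim S + dim (orth_compl b S) = dim (UNIV :: 'a set)"
proof -
  obtain B where B: "B \<subseteq> S" "independent B" "S \<subseteq> span B" "card B = dim S"
    by (rule basis_exists)
  have S_eq: "S = span B" using B S by (simp add: span_minimal subset_antisym)
  obtain C where BC: "B \<subseteq> C" and C: "finite_basis C"
    by (rule finite_basis_extending[OF assms(1) B(2)])
  then have C': "finite C" "independent C" "span C = UNIV" by (simp_all add: finite_basis_iff)
  define f where "f x = coefficient_vector C (b x)" for x
  have f: "linear f" "inj f"
    using linear_coefficient_vector inj_coefficient_vector[OF C] by (simp_all add: f_def[abs_def])
  interpret finite_dimensional_vector_space_pair_1
    "(*\<^sub>R) :: real \<Rightarrow> 'a \<Rightarrow> 'a" C "(*\<^sub>R) :: real \<Rightarrow> 'a \<Rightarrow> 'a"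
    using C by (simp add: finite_dimensional_vector_space_pair_1_def real_vector.vector_space_axioms)
  have "surj f" using f vs1.linear_inj_imp_surj by (simp add: linear_def)
  have "orth_compl b S = orth_compl b B" by (simp add: S_eq orth_compl_span)
  also have "\<dots> = f -` span (C - B)"
    by (auto simp: orth_compl_def f_def coefficient_vector_in_span_Diff_iff[OF C'(1,2) BC])
  finally have "f ` orth_compl b S = span (C - B)"
    using \<open>surj f\<close> by (simp add: surj_image_vimage_eq)
  moreover have "dim (f ` orth_compl b S) = dim (orth_compl b S)"
    using f dim_image_eq[of f "orth_compl b S"]
    by (simp add: linear_def dim_raw_def inj_on_subset)
  moreover have "dim (span (C - B)) = card C - card B"
    using C' BC independent_mono[OF C'(2)]
    by (simp add: dim_eq_card_independent card_Diff_subset finite_subset)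
  moreover have "card C = dim (UNIV :: 'a set)"
    using C' by (simp add: basis_card_eq_dim)
  ultimately show ?thesis
    using B(4) card_mono[OF C'(1) BC] by simp
qed

lemma dirac_structure_iff_orth_compl_eq:
  fixes C L :: "'a set"
  assumes C: "finite_basis C"
  shows "dirac_structure b L \<longleftrightarrow> orth_compl b L = L"
proof
  interpret finite_dimensional_vector_space "(*\<^sub>R) :: real \<Rightarrow> 'a \<Rightarrow> 'a" C by fact
  assume "dirac_structure b L"
  then have L: "subspace L" "L \<subseteq> orth_compl b L" and "2 * dim L = dim (UNIV :: 'a set)"
    by (auto simp: dirac_structure_def isotropic_subspace_def subset_orth_compl_iff)
  moreover from this have "dim (orth_compl b L) \<le> dim L"
    using dim_orth_compl[OF C L(1)] by simp
  ultimately show "orth_compl b L = L"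
    using subspace_orth_compl[of L] subspace_dim_equal[of L "orth_compl b L"]
    by (simp add: subspace_raw_def dim_raw_def)
next
  assume L: "orth_compl b L = L"
  then have "subspace L" by (rule subspace_if_orth_compl_eq)
  moreover have "L' = L" if "isotropic_subspace b L'" "L \<subseteq> L'" for L'
  proof -
    have "L' \<subseteq> orth_compl b L'"
      using that(1) by (simp add: isotropic_subspace_def subset_orth_compl_iff)
    then show ?thesis using orth_compl_antimono[OF that(2)] that(2) L by blast
  qed
  ultimately show "dirac_structure b L"
    using dim_orth_compl[OF C, of L] L subset_orth_compl_iff[of L b L]
    by (simp add: dirac_structure_def isotropic_subspace_def)
qed

subsection \<open>The scalar product on \<open>V \<oplus> V\<^sup>* \<oplus> \<gg>\<close>\<close>

lemma bilinear_sum_form: "bilinear (sum_form b)"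
  by (auto simp: bilinear_def linear_iff sum_form_def form_simps dual_apply_simps field_simps)

lemma sum_form_nondegenerate:
  assumes orth: "\<And>w. sum_form b z w = 0"
  shows "z = 0"
proof -
  obtain X \<xi> r where z: "z = (X, \<xi>, r)" by (cases z)
  have "r = 0"
    using orth[of "(0, 0, s)" for s]
    by (intro nondegenerate) (simp add: z sum_form_def dual_apply_simps)
  moreover have "\<xi> = 0"
    using orth[of "(Y, 0, 0)" for Y]
    by (intro dual_eqI) (simp add: z sum_form_def dual_apply_simps form_simps)
  moreover have "X = 0"
  proof (rule ccontr)
    assume "X \<noteq> 0"
    then obtain \<eta> where "dual_apply \<eta> X \<noteq> 0"
      using ex_annihilator_separating[OF subspace_single_0, of X] by auto
    then show False
      using orth[of "(0, \<eta>, 0)"] by (simp add: z sum_form_def dual_apply_simps form_simps)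
  qed
  ultimately show ?thesis by (simp add: z zero_prod_def)
qed

lemma scalar_product_sum_form: "scalar_product (sum_form b)"
proof
  have "sum_form b z w = sum_form b w z" for z w :: "('b, 'a) sum_space"
    by (simp add: sum_form_def commute split: prod.split)
  then show "is_scalar_product (sum_form b :: ('b, 'a) sum_space \<Rightarrow> _)"
    using bilinear_sum_form sum_form_nondegenerate by (simp only: is_scalar_product_def) blast
qed

lemma orth_compl_Times_annihilator:
  assumes W: "subspace W" and D: "subspace D"
  shows "orth_compl (sum_form b) (W \<times> annihilator W \<times> D) = W \<times> annihilator W \<times> orth_compl b D"
    (is "orth_compl _ ?S = ?T")
proof (intro subset_antisym subsetI)
  fix z assume "z \<in> orth_compl (sum_form b) ?S"
  moreover obtain X \<xi> r where z: "z = (X, \<xi>, r)" by (cases z)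
  ultimately have orth: "sum_form b (X, \<xi>, r) (Y, \<eta>, s) = 0"
    if "Y \<in> W" "\<eta> \<in> annihilator W" "s \<in> D" for Y \<eta> s
    using that by (simp add: orth_compl_def)
  have zeros: "0 \<in> W" "0 \<in> annihilator W" "0 \<in> D"
    using W D by (simp_all add: subspace_0 annihilator_def dual_apply_simps)
  have "X \<in> W"
  proof (rule ccontr)
    assume "X \<notin> W"
    then obtain \<eta> where "\<eta> \<in> annihilator W" "dual_apply \<eta> X \<noteq> 0"
      using ex_annihilator_separating[OF W] by blast
    then show False
      using orth[of 0 \<eta> 0] zeros by (simp add: sum_form_def dual_apply_simps form_simps)
  qed
  moreover have "\<xi> \<in> annihilator W"
    using orth[of _ 0 0] zeros
    by (simp add: annihilator_def sum_form_def dual_apply_simps form_simps)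
  moreover have "r \<in> orth_compl b D"
    using orth[of 0 0] zeros by (simp add: orth_compl_def sum_form_def dual_apply_simps)
  ultimately show "z \<in> ?T" by (simp add: z)
qed (auto simp: orth_compl_def annihilator_def sum_form_def)

end

subsection \<open>Shears\<close>

text \<open>Unspecified unless \<open>Abs_dual\<close> is applied to a linear map, as for linear \<open>\<sigma>\<close> and bilinear \<open>\<epsilon>\<close>.\<close>

definition shear_dual ::
  "('g::real_vector \<Rightarrow> 'g \<Rightarrow> real) \<Rightarrow> ('v::real_vector \<Rightarrow> 'g) \<Rightarrow> ('v \<Rightarrow> 'v \<Rightarrow> real) \<Rightarrow>
   'v \<Rightarrow> 'g \<Rightarrow> 'v dual" where
  "shear_dual b \<sigma> \<epsilon> X r = Abs_dual (\<lambda>Y. 2 * \<epsilon> X Y - b (\<sigma> Y) (\<sigma> X + 2 *\<^sub>R r))"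

definition shear ::
  "('g::real_vector \<Rightarrow> 'g \<Rightarrow> real) \<Rightarrow> ('v::real_vector \<Rightarrow> 'g) \<Rightarrow> ('v \<Rightarrow> 'v \<Rightarrow> real) \<Rightarrow>
   ('v, 'g) sum_space \<Rightarrow> ('v, 'g) sum_space" where
  "shear b \<sigma> \<epsilon> = (\<lambda>(X, \<xi>, r). (X, \<xi> + shear_dual b \<sigma> \<epsilon> X r, \<sigma> X + r))"

lemma surj_shear: "surj (shear b \<sigma> \<epsilon>)"
proof (rule surjI)
  show "shear b \<sigma> \<epsilon> (case z of (X, \<xi>, t) \<Rightarrow> (X, \<xi> - shear_dual b \<sigma> \<epsilon> X (t - \<sigma> X), t - \<sigma> X)) = z" for z
    by (cases z) (simp add: shear_def)
qed

lemma dirac_of_data_cong: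
  assumes "\<And>X. X \<in> W \<Longrightarrow> \<sigma> X = \<sigma>' X" "\<And>X Y. X \<in> W \<Longrightarrow> Y \<in> W \<Longrightarrow> \<epsilon> X Y = \<epsilon>' X Y"
  shows "dirac_of_data b W D \<sigma> \<epsilon> = dirac_of_data b W D \<sigma>' \<epsilon>'"
  using assms by (force simp: dirac_of_data_def)

context scalar_product
begin

lemma dual_apply_shear_dual:
  assumes "linear \<sigma>" "bilinear \<epsilon>"
  shows "dual_apply (shear_dual b \<sigma> \<epsilon> X r) Y = 2 * \<epsilon> X Y - b (\<sigma> Y) (\<sigma> X + 2 *\<^sub>R r)"
proof -
  have "linear (\<lambda>Y. 2 * \<epsilon> X Y - b (\<sigma> Y) (\<sigma> X + 2 *\<^sub>R r))"
    by (rule linearI) (simp_all add: linear_add[OF assms(1)] linear_cmul[OF assms(1)]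
        bilinear_radd[OF assms(2)] bilinear_rmul[OF assms(2)] form_simps algebra_simps)
  then show ?thesis by (simp add: shear_dual_def dual_apply_Abs_dual)
qed

lemma sum_form_shear:
  assumes "linear \<sigma>" "bilinear \<epsilon>" "\<And>X. \<epsilon> X X = 0"
  shows "sum_form b (shear b \<sigma> \<epsilon> z) (shear b \<sigma> \<epsilon> w) = sum_form b z w"
proof -
  obtain X \<xi> r Y \<eta> s where "z = (X, \<xi>, r)" "w = (Y, \<eta>, s)" by (metis prod_cases3)
  then show ?thesis
    using bilinear_alternating_swap[OF assms(2,3), of X Y]
    by (simp add: shear_def sum_form_def dual_apply_simps dual_apply_shear_dual[OF assms(1,2)]
        form_simps commute field_simps)
qed

lemma dirac_of_data_eq_shear_image:
  assumes "linear \<sigma>" "bilinear \<epsilon>"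
  shows "dirac_of_data b W D \<sigma> \<epsilon> = shear b \<sigma> \<epsilon> ` (W \<times> annihilator W \<times> D)"
proof (intro subset_antisym subsetI)
  fix z assume "z \<in> dirac_of_data b W D \<sigma> \<epsilon>"
  then obtain X \<xi> r where z: "z = (X, \<xi>, \<sigma> X + r)" and "X \<in> W" "r \<in> D"
    and "\<forall>Y\<in>W. dual_apply \<xi> Y = 2 * \<epsilon> X Y - b (\<sigma> Y) (\<sigma> X + 2 *\<^sub>R r)"
    by (auto simp: dirac_of_data_def)
  then have "(X, \<xi> - shear_dual b \<sigma> \<epsilon> X r, r) \<in> W \<times> annihilator W \<times> D"
    by (simp add: annihilator_def dual_apply_simps dual_apply_shear_dual[OF assms])
  moreover have "z = shear b \<sigma> \<epsilon> (X, \<xi> - shear_dual b \<sigma> \<epsilon> X r, r)" by (simp add: z shear_def)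
  ultimately show "z \<in> shear b \<sigma> \<epsilon> ` (W \<times> annihilator W \<times> D)" by blast
qed (auto simp: dirac_of_data_def shear_def annihilator_def dual_apply_simps
      dual_apply_shear_dual[OF assms])

lemma ex_dirac_of_data_eq_shear_image:
  assumes "subspace W" "linear_on W \<sigma>" "alternating_form_on W \<epsilon>"
  obtains \<sigma>' \<epsilon>' where "linear \<sigma>'" "bilinear \<epsilon>'" "\<And>X. \<epsilon>' X X = 0" "\<And>X. X \<in> W \<Longrightarrow> \<sigma>' X = \<sigma> X"
    "dirac_of_data b W D \<sigma> \<epsilon> = shear b \<sigma>' \<epsilon>' ` (W \<times> annihilator W \<times> D)"
proof -
  obtain \<sigma>' where \<sigma>': "linear \<sigma>'" "\<And>X. X \<in> W \<Longrightarrow> \<sigma>' X = \<sigma> X"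
    using ex_linear_extending[OF assms(1,2)] by blast
  obtain \<epsilon>' where \<epsilon>': "bilinear \<epsilon>'" "\<And>X. \<epsilon>' X X = 0"
      "\<And>X Y. X \<in> W \<Longrightarrow> Y \<in> W \<Longrightarrow> \<epsilon>' X Y = \<epsilon> X Y"
    using ex_bilinear_alternating_extending[OF assms(1,3)] by blast
  have "dirac_of_data b W D \<sigma> \<epsilon> = dirac_of_data b W D \<sigma>' \<epsilon>'"
    using \<sigma>'(2) \<epsilon>'(3) by (intro dirac_of_data_cong) simp_all
  then show thesis
    using that \<sigma>' \<epsilon>'(1,2) dirac_of_data_eq_shear_image[OF \<sigma>'(1) \<epsilon>'(1)] by metis
qed

lemma orth_compl_dirac_of_data:
  assumes "subspace W" "linear_on W \<sigma>" "alternating_form_on W \<epsilon>" and D: "orth_compl b D = D"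
  shows "orth_compl (sum_form b) (dirac_of_data b W D \<sigma> \<epsilon>) = dirac_of_data b W D \<sigma> \<epsilon>"
proof -
  obtain \<sigma>' \<epsilon>' where "linear \<sigma>'" "bilinear \<epsilon>'" "\<And>X. \<epsilon>' X X = 0"
    and L: "dirac_of_data b W D \<sigma> \<epsilon> = shear b \<sigma>' \<epsilon>' ` (W \<times> annihilator W \<times> D)"
    using ex_dirac_of_data_eq_shear_image[OF assms(1-3)] by metis
  then have "orth_compl (sum_form b) (shear b \<sigma>' \<epsilon>' ` S) =
      shear b \<sigma>' \<epsilon>' ` orth_compl (sum_form b) S" for S
    by (intro orth_compl_image_isometry surj_shear sum_form_shear)
  moreover have "subspace D" using D by (rule subspace_if_orth_compl_eq)
  ultimately show ?thesis
    by (simp add: L orth_compl_Times_annihilator[OF assms(1)] D)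
qed

end

subsection \<open>Data of a self-orthogonal subspace\<close>

lemma mem_fibre_g_iff: "r \<in> fibre_g L X \<longleftrightarrow> (\<exists>\<xi>. (X, \<xi>, r) \<in> L)"
  by (force simp: fibre_g_def proj_g_def proj_V_def)

lemma mem_proj_V_image_iff: "X \<in> proj_V ` L \<longleftrightarrow> (\<exists>\<xi> r. (X, \<xi>, r) \<in> L)"
  by (force simp: proj_V_def)

lemma linear_proj_V: "linear proj_V"
  by (auto intro!: linearI simp: proj_V_def)

lemma ex_linear_section_proj_V:
  fixes L :: "('v::real_vector, 'g::real_vector) sum_space set"
  assumes "subspace L"
  obtains \<alpha> \<sigma> where "linear \<alpha>" "linear \<sigma>" "\<And>X. X \<in> proj_V ` L \<Longrightarrow> (X, \<alpha> X, \<sigma> X) \<in> L"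
proof -
  obtain \<tau> where \<tau>: "linear \<tau>" "\<And>X. \<tau> X \<in> L" "\<And>X. X \<in> proj_V ` L \<Longrightarrow> proj_V (\<tau> X) = X"
    using linear_exists_right_inverse_on[OF linear_proj_V assms] by blast
  show thesis
  proof
    show "linear (\<lambda>X. fst (snd (\<tau> X)))" "linear (\<lambda>X. snd (snd (\<tau> X)))"
      using \<tau>(1) by (simp_all add: linear_iff)
    show "(X, fst (snd (\<tau> X)), snd (snd (\<tau> X))) \<in> L" if "X \<in> proj_V ` L" for X
      using \<tau>(2,3)[of X] that by (cases "\<tau> X") (simp add: proj_V_def)
  qed
qed

lemma diff_in_fibre_g_0:
  assumes "subspace L" "(X, \<xi>, r) \<in> L" "(X, \<eta>, s) \<in> L"
  shows "r - s \<in> fibre_g L 0"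
  using subspace_diff[OF assms] by (auto simp: mem_fibre_g_iff)

definition section_form ::
  "('g \<Rightarrow> 'g \<Rightarrow> real) \<Rightarrow> ('v::real_vector \<Rightarrow> 'v dual) \<Rightarrow> ('v \<Rightarrow> 'g) \<Rightarrow> 'v \<Rightarrow> 'v \<Rightarrow> real" where
  "section_form b \<alpha> \<sigma> X Y = (dual_apply (\<alpha> X) Y + b (\<sigma> Y) (\<sigma> X)) / 2"

context scalar_product
begin

lemma alternating_form_on_section_form:
  assumes lin: "linear \<alpha>" "linear \<sigma>"
    and iso: "\<And>X. X \<in> W \<Longrightarrow> sum_form b (X, \<alpha> X, \<sigma> X) (X, \<alpha> X, \<sigma> X) = 0"
  shows "alternating_form_on W (section_form b \<alpha> \<sigma>)"
proof -
  have "section_form b \<alpha> \<sigma> X X = 0" if "X \<in> W" for X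
    using iso[OF that] by (simp add: section_form_def sum_form_def)
  then show ?thesis
    by (simp add: alternating_form_on_def linear_on_def)
      (simp add: section_form_def linear_add[OF lin(1)] linear_cmul[OF lin(1)]
        linear_add[OF lin(2)] linear_cmul[OF lin(2)] form_simps dual_apply_simps field_simps)
qed

lemma orth_compl_fibre_g_0:
  assumes L: "orth_compl (sum_form b) L = L"
  shows "orth_compl b (fibre_g L 0) = fibre_g L 0"
proof (intro subset_antisym subsetI)
  have sub: "subspace L"
    using scalar_product_sum_form L by (rule scalar_product.subspace_if_orth_compl_eq)
  obtain \<alpha> \<sigma> where "linear \<sigma>" and sec: "\<And>X. X \<in> proj_V ` L \<Longrightarrow> (X, \<alpha> X, \<sigma> X) \<in> L"
    using ex_linear_section_proj_V[OF sub] by metis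
  fix s assume s: "s \<in> orth_compl b (fibre_g L 0)"
  \<comment> \<open>On \<open>proj_V ` L\<close>, orthogonality to the section leaves no other choice.\<close>
  define \<xi> where "\<xi> = Abs_dual (\<lambda>X. - 2 * b s (\<sigma> X))"
  have "linear (\<lambda>X. - 2 * b s (\<sigma> X))"
    by (rule linearI)
      (simp_all add: linear_add[OF \<open>linear \<sigma>\<close>] linear_cmul[OF \<open>linear \<sigma>\<close>] form_simps algebra_simps)
  then have \<xi>: "dual_apply \<xi> X = - 2 * b s (\<sigma> X)" for X
    by (simp add: \<xi>_def dual_apply_Abs_dual)
  have "sum_form b (0, \<xi>, s) (X, \<eta>, t) = 0" if "(X, \<eta>, t) \<in> L" for X \<eta> t
  proof -
    have "(X, \<alpha> X, \<sigma> X) \<in> L" using sec that by (auto simp: mem_proj_V_image_iff)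
    then have "b s (t - \<sigma> X) = 0"
      using s diff_in_fibre_g_0[OF sub that] by (simp add: orth_compl_def)
    then show ?thesis by (simp add: sum_form_def \<xi> form_simps dual_apply_simps)
  qed
  then have "(0, \<xi>, s) \<in> orth_compl (sum_form b) L" by (auto simp: orth_compl_def)
  then show "s \<in> fibre_g L 0" using L by (auto simp: mem_fibre_g_iff)
next
  fix s assume "s \<in> fibre_g L 0"
  then obtain \<xi> where "(0, \<xi>, s) \<in> orth_compl (sum_form b) L" by (auto simp: mem_fibre_g_iff L)
  then show "s \<in> orth_compl b (fibre_g L 0)"
    by (fastforce simp: orth_compl_def mem_fibre_g_iff sum_form_def dual_apply_simps)
qed

lemma subset_dirac_of_data_section_form:
  assumes sub: "subspace L" and iso: "\<And>z w. z \<in> L \<Longrightarrow> w \<in> L \<Longrightarrow> sum_form b z w = 0"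
    and sec: "\<And>X. X \<in> proj_V ` L \<Longrightarrow> (X, \<alpha> X, \<sigma> X) \<in> L"
  shows "L \<subseteq> dirac_of_data b (proj_V ` L) (fibre_g L 0) \<sigma> (section_form b \<alpha> \<sigma>)"
proof (intro subrelI)
  fix X \<xi>t assume "(X, \<xi>t) \<in> L"
  then obtain \<xi> t where \<xi>t: "\<xi>t = (\<xi>, t)" and z: "(X, \<xi>, t) \<in> L" by (cases \<xi>t) auto
  have X: "X \<in> proj_V ` L" using z by (auto simp: mem_proj_V_image_iff)
  have r: "t - \<sigma> X \<in> fibre_g L 0" using sub z sec[OF X] by (rule diff_in_fibre_g_0)
  have "dual_apply \<xi> Y = 2 * section_form b \<alpha> \<sigma> X Y - b (\<sigma> Y) (\<sigma> X + 2 *\<^sub>R (t - \<sigma> X))"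
    if Y: "Y \<in> proj_V ` L" for Y
    using iso[OF z sec[OF Y]] iso[OF sec[OF X] sec[OF Y]]
    by (simp add: sum_form_def section_form_def form_simps commute field_simps)
  then show "(X, \<xi>t) \<in> dirac_of_data b (proj_V ` L) (fibre_g L 0) \<sigma> (section_form b \<alpha> \<sigma>)"
    using X r unfolding \<xi>t dirac_of_data_def by force
qed

lemma eq_dirac_of_data_if_orth_compl_eq:
  assumes L: "orth_compl (sum_form b) L = L"
  obtains \<sigma> \<epsilon> where "subspace (proj_V ` L)" "linear_on (proj_V ` L) \<sigma>"
    "alternating_form_on (proj_V ` L) \<epsilon>" "L = dirac_of_data b (proj_V ` L) (fibre_g L 0) \<sigma> \<epsilon>"
proof -
  have sub: "subspace L"
    using scalar_product_sum_form L by (rule scalar_product.subspace_if_orth_compl_eq)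
  have iso: "\<And>z w. z \<in> L \<Longrightarrow> w \<in> L \<Longrightarrow> sum_form b z w = 0"
    using L subset_orth_compl_iff[of L "sum_form b" L] by blast
  obtain \<alpha> \<sigma> where lin: "linear \<alpha>" "linear \<sigma>"
    and sec: "\<And>X. X \<in> proj_V ` L \<Longrightarrow> (X, \<alpha> X, \<sigma> X) \<in> L"
    using ex_linear_section_proj_V[OF sub] by metis
  have W: "subspace (proj_V ` L)"
    using linear_proj_V sub by (rule linear_subspace_image)
  have \<sigma>: "linear_on (proj_V ` L) \<sigma>"
    using lin(2) by (simp add: linear_on_def linear_iff)
  have \<epsilon>: "alternating_form_on (proj_V ` L) (section_form b \<alpha> \<sigma>)"
    using iso sec by (intro alternating_form_on_section_form lin) blast
  let ?L = "dirac_of_data b (proj_V ` L) (fibre_g L 0) \<sigma> (section_form b \<alpha> \<sigma>)"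
  have "L \<subseteq> ?L"
    using sub iso sec by (rule subset_dirac_of_data_section_form)
  moreover from this have "?L \<subseteq> L"
    using orth_compl_antimono[of L ?L "sum_form b"] L
      orth_compl_dirac_of_data[OF W \<sigma> \<epsilon> orth_compl_fibre_g_0[OF L]] by simp
  ultimately have "L = ?L" by (rule subset_antisym)
  with W \<sigma> \<epsilon> show thesis by (rule that)
qed

lemma in_fibre_g_dirac_of_data:
  assumes "subspace W" "linear_on W \<sigma>" "alternating_form_on W \<epsilon>" "subspace D" "X \<in> W"
  shows "\<sigma> X \<in> fibre_g (dirac_of_data b W D \<sigma> \<epsilon>) X"
proof -
  obtain \<sigma>' \<epsilon>' where \<sigma>': "\<And>X. X \<in> W \<Longrightarrow> \<sigma>' X = \<sigma> X"
    and L: "dirac_of_data b W D \<sigma> \<epsilon> = shear b \<sigma>' \<epsilon>' ` (W \<times> annihilator W \<times> D)"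
    using ex_dirac_of_data_eq_shear_image[OF assms(1-3)] by metis
  have "shear b \<sigma>' \<epsilon>' (X, 0, 0) \<in> dirac_of_data b W D \<sigma> \<epsilon>"
    using assms(5) subspace_0[OF assms(4)] unfolding L by (simp add: annihilator_def dual_apply_simps)
  then show ?thesis
    using \<sigma>'[OF \<open>X \<in> W\<close>] by (auto simp: mem_fibre_g_iff shear_def)
qed

end

theorem proposition11:
  fixes BV :: "'v::real_vector set" and BG :: "'g::real_vector set"
    and b :: "'g \<Rightarrow> 'g \<Rightarrow> real"
  assumes "finite_dimensional_vector_space ((*\<^sub>R) :: real \<Rightarrow> 'v \<Rightarrow> 'v) BV"
    and "finite_dimensional_vector_space ((*\<^sub>R) :: real \<Rightarrow> 'g \<Rightarrow> 'g) BG"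
    and "is_scalar_product b" and "neutral_signature b"
  shows "(\<forall>L :: ('v, 'g) sum_space set. dirac_structure (sum_form b) L \<longrightarrow>
            (\<exists>W D \<sigma> \<epsilon>. dirac_data b W D \<sigma> \<epsilon> \<and> L = dirac_of_data b W D \<sigma> \<epsilon>)) \<and>
         (\<forall>(W :: 'v set) D \<sigma> \<epsilon>. dirac_data b W D \<sigma> \<epsilon> \<longrightarrow>
            dirac_structure (sum_form b) (dirac_of_data b W D \<sigma> \<epsilon>)) \<and>
         (\<forall>(W :: 'v set) D \<sigma> \<epsilon>. dirac_data b W D \<sigma> \<epsilon> \<longrightarrow>
            (\<forall>X\<in>W. \<sigma> X \<in> fibre_g (dirac_of_data b W D \<sigma> \<epsilon>) X))"
proof (intro conjI allI impI ballI)
  interpret scalar_product b by unfold_locales fact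
  obtain C :: "('v, 'g) sum_space set" where C: "finite_basis C"
    using finite_basis_sum_space[OF assms(1,2)] .
  note dirac_iff = dirac_structure_iff_orth_compl_eq[OF assms(2)]
  note dirac_sum_form_iff =
    scalar_product.dirac_structure_iff_orth_compl_eq[OF scalar_product_sum_form C]
  show "\<exists>W D \<sigma> \<epsilon>. dirac_data b W D \<sigma> \<epsilon> \<and> L = dirac_of_data b W D \<sigma> \<epsilon>"
    if "dirac_structure (sum_form b) L" for L :: "('v, 'g) sum_space set"
  proof -
    have L: "orth_compl (sum_form b) L = L" using that by (simp only: dirac_sum_form_iff)
    show ?thesis
      using eq_dirac_of_data_if_orth_compl_eq[OF L] orth_compl_fibre_g_0[OF L]
      unfolding dirac_data_def dirac_iff by metis
  qed
  fix W :: "'v set" and D \<sigma> \<epsilon>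
  assume data: "dirac_data b W D \<sigma> \<epsilon>"
  show "dirac_structure (sum_form b) (dirac_of_data b W D \<sigma> \<epsilon>)"
    using data unfolding dirac_data_def dirac_iff dirac_sum_form_iff
    by (simp add: orth_compl_dirac_of_data)
  show "\<sigma> X \<in> fibre_g (dirac_of_data b W D \<sigma> \<epsilon>) X" if "X \<in> W" for X
    using data that
    by (simp add: in_fibre_g_dirac_of_data dirac_data_def dirac_structure_def isotropic_subspace_def)
qed

end
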